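(* Let $n,m,T\ge 1$, $\gamma\in(0,1)$, $A\in\mathbb{R}^{n\times n}$, $B\in\mathbb{R}^{n\times m}$ with $(A,B)$ stabilizable, and for $(x,u)\in\mathbb{R}^n\times\mathbb{R}^m$ let $$H(x,u)=xx^\intercal-\gamma(Ax+Bu)(Ax+Bu)^\intercal .$$ Let $(X,U,X^+)$ be a dataset of length $T$, i.e. $X=[x^1\ \cdots\ x^T]\in\mathbb{R}^{n\times T}$, $U=[u^1\ \cdots\ u^T]\in\mathbb{R}^{m\times T}$ and $X^+=AX+BU$, satisfying $$\mathrm{rank}\begin{bmatrix}X\\ U\end{bmatrix}=n+m .$$ Then for each $(x,u)\in\mathbb{R}^n\times\mathbb{R}^m$ there exists $\alpha\in\mathbb{R}^T$ such that $$H(x,u)=(X\alpha)(X\alpha)^\intercal-\gamma(X^+\alpha)(X^+\alpha)^\intercal .$$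
   Context: The underlying system is the deterministic linear system $x^+=Ax+Bu$, with discount factor $\gamma$; the columns of $X^+$ are the next states observed from the state-input pairs given by the columns of $X$ and $U$. *)

theory Defs
  imports "HOL-Analysis.Analysis"
begin

(* Eigenvalues of a real matrix are taken over the complex numbers. *)
definition is_eigenvalue :: "real^'n^'n \<Rightarrow> complex \<Rightarrow> bool" where
  "is_eigenvalue M z \<longleftrightarrow>
     (\<exists>v :: complex^'n. v \<noteq> 0 \<and> map_matrix complex_of_real M *v v = z *s v)"

definition schur_stable :: "real^'n^'n \<Rightarrow> bool" where
  "schur_stable M \<longleftrightarrow> (\<forall>z. is_eigenvalue M z \<longrightarrow> norm z < 1)"

(* Discrete-time stabilizability: some static state feedback u = K x makes the
   closed loop x' = (A + B K) x asymptotically stable. *)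
definition stabilizable :: "real^'n^'n \<Rightarrow> real^'m^'n \<Rightarrow> bool" where
  "stabilizable A B \<longleftrightarrow> (\<exists>K :: real^'n^'m. schur_stable (A + B ** K))"

definition outer_self :: "real^'n \<Rightarrow> real^'n^'n" where
  "outer_self v = (columnvector v :: real^1^'n) ** transpose (columnvector v)"

definition H_mat :: "real \<Rightarrow> real^'n^'n \<Rightarrow> real^'m^'n \<Rightarrow> real^'n \<Rightarrow> real^'m \<Rightarrow> real^'n^'n" where
  "H_mat \<gamma> A B x u = outer_self x - \<gamma> *\<^sub>R outer_self (A *v x + B *v u)"

(* The columns of X, U, Xp, indexed by 't, are the samples. *)
definition is_dataset ::
    "real^'n^'n \<Rightarrow> real^'m^'n \<Rightarrow> real^'t^'n \<Rightarrow> real^'t^'m \<Rightarrow> real^'t^'n \<Rightarrow> bool" where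
  "is_dataset A B X U Xp \<longleftrightarrow> Xp = A ** X + B ** U"

definition vstack :: "real^'t^'n \<Rightarrow> real^'t^'m \<Rightarrow> real^'t^('n + 'm)" where
  "vstack X U = (\<chi> i. case i of Inl a \<Rightarrow> X $ a | Inr b \<Rightarrow> U $ b)"

end

theory Submission
  imports Defs
begin

text \<open>The matrix $H(x,u)$ depends on the pair $(x,u)$ only through $x$ and the successor state
$Ax+Bu$. If $\alpha$ satisfies $X\alpha = x$ and $U\alpha = u$, then linearity of the dynamics gives
$X^+\alpha = A(X\alpha) + B(U\alpha) = Ax+Bu$, and the two sides of the claim agree term by term.
Such an $\alpha$ exists for every $(x,u)$ because full row rank of the stacked data matrix means
precisely that it is surjective onto the state-input space.\<close>

lemma vstack_mult_vec_nth:
  fixes X :: "real^'t^'n" and U :: "real^'t^'m"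
  shows "(vstack X U *v \<alpha>) $ Inl i = (X *v \<alpha>) $ i"
    and "(vstack X U *v \<alpha>) $ Inr j = (U *v \<alpha>) $ j"
  by (simp_all add: vstack_def matrix_vector_mult_def)

text \<open>The rank equals the number of rows of the stacked matrix, so its range is the whole
state-input space. Stacking is what makes a single $\alpha$ serve both equations: full row rank of
$X$ and of $U$ separately would only give one solution for each.\<close>

lemma full_row_rank_vstack_solvable:
  fixes X :: "real^'t^'n" and U :: "real^'t^'m"
  assumes "rank (vstack X U) = CARD('n) + CARD('m)"
  obtains \<alpha> where "X *v \<alpha> = x" and "U *v \<alpha> = u"
proof -
  have "surj ((*v) (vstack X U))"
    using assms by (simp flip: full_rank_surjective)
  then obtain \<alpha> where
    \<alpha>: "vstack X U *v \<alpha> = (\<chi> k. case k of Inl i \<Rightarrow> x $ i | Inr j \<Rightarrow> u $ j)"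
    by (metis surjD)
  show thesis
  proof
    show "X *v \<alpha> = x"
      by (simp add: vec_eq_iff flip: vstack_mult_vec_nth(1)[of X U]) (simp add: \<alpha>)
    show "U *v \<alpha> = u"
      by (simp add: vec_eq_iff flip: vstack_mult_vec_nth(2)[of X U]) (simp add: \<alpha>)
  qed
qed

lemma dataset_successor_mult_vec:
  assumes "is_dataset A B X U Xp"
  shows "Xp *v \<alpha> = A *v (X *v \<alpha>) + B *v (U *v \<alpha>)"
  using assms
  by (simp add: is_dataset_def matrix_vector_mult_add_rdistrib matrix_vector_mul_assoc)

theorem lemma1:
  fixes \<gamma> :: real
    and A :: "real^'n^'n" and B :: "real^'m^'n"
    and X :: "real^'t^'n" and U :: "real^'t^'m" and Xp :: "real^'t^'n"
  assumes "0 < \<gamma>" and "\<gamma> < 1"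
    and "stabilizable A B"
    and "is_dataset A B X U Xp"
    and "rank (vstack X U) = CARD('n) + CARD('m)"
  shows "\<forall>(x :: real^'n) (u :: real^'m). \<exists>\<alpha> :: real^'t.
           H_mat \<gamma> A B x u = outer_self (X *v \<alpha>) - \<gamma> *\<^sub>R outer_self (Xp *v \<alpha>)"
proof (intro allI)
  fix x :: "real^'n" and u :: "real^'m"
  obtain \<alpha> where "X *v \<alpha> = x" and "U *v \<alpha> = u"
    using full_row_rank_vstack_solvable[OF assms(5)] .
  then have "H_mat \<gamma> A B x u = outer_self (X *v \<alpha>) - \<gamma> *\<^sub>R outer_self (Xp *v \<alpha>)"
    by (simp add: H_mat_def dataset_successor_mult_vec[OF assms(4)])
  then show "\<exists>\<alpha>. H_mat \<gamma> A B x u = outer_self (X *v \<alpha>) - \<gamma> *\<^sub>R outer_self (Xp *v \<alpha>)" ..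
qed

end
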